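(* Let $R$ be a ring and $\sigma:R\to R$ a ring homomorphism. Then the unit element is the only idempotent in the skew power series ring $R[[x;\sigma]]$ that has constant term $1_R$.
   Context: Rings are associative and unital (not necessarily commutative), and ring homomorphisms preserve unit elements. The skew power series ring $R[[x;\sigma]]$ consists of all formal power series $\sum_{i\ge 0} r_i x^i$ with coefficients $r_i\in R$ written on the left, with the usual addition and with multiplication governed by $xr=\sigma(r)x$ for $r\in R$, that is, $\left(\sum_{i} r_ix^i\right)\left(\sum_j s_jx^j\right)=\sum_{k}\left(\sum_{i+j=k} r_i\sigma^i(s_j)\right)x^k$. *)

theory Defs
  imports "HOL-Algebra.Ring"
begin

text \<open>
  A skew power series \<open>\<Sum>i. r\<^sub>i x\<^sup>i\<close> is represented by its coefficient sequence \<open>i \<mapsto> r\<^sub>i\<close>,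
  coefficients being written on the left of the powers of \<open>x\<close>; its constant term is the value at \<open>0\<close>.
  The multiplication is the one forced by \<open>x r = \<sigma>(r) x\<close>.
\<close>

definition skew_fps_ring :: "('a, 'b) ring_scheme \<Rightarrow> ('a \<Rightarrow> 'a) \<Rightarrow> (nat \<Rightarrow> 'a) ring" where
  "skew_fps_ring R \<sigma> =
     \<lparr> carrier = {f. \<forall>i. f i \<in> carrier R},
       mult = (\<lambda>f g k. \<Oplus>\<^bsub>R\<^esub>i\<in>{..k}. f i \<otimes>\<^bsub>R\<^esub> (\<sigma> ^^ i) (g (k - i))),
       one = (\<lambda>i. if i = 0 then \<one>\<^bsub>R\<^esub> else \<zero>\<^bsub>R\<^esub>),
       zero = (\<lambda>i. \<zero>\<^bsub>R\<^esub>),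
       add = (\<lambda>f g i. f i \<oplus>\<^bsub>R\<^esub> g i) \<rparr>"

definition idempotent_elem :: "('a, 'b) monoid_scheme \<Rightarrow> 'a \<Rightarrow> bool" where
  "idempotent_elem M e \<longleftrightarrow> e \<in> carrier M \<and> e \<otimes>\<^bsub>M\<^esub> e = e"

lemma ring_hom_funpow:
  assumes "\<sigma> \<in> ring_hom R R"
  shows "\<sigma> ^^ n \<in> ring_hom R R"
proof (induction n)
  case 0
  show ?case by (auto simp: ring_hom_def)
next
  case (Suc n)
  with assms show ?case by (auto simp: ring_hom_def Pi_def)
qed

lemma (in ring) finsum_triangle:
  fixes u :: "nat \<Rightarrow> nat \<Rightarrow> 'a"
  assumes "\<And>i j. u i j \<in> carrier R"
  shows "(\<Oplus>i\<in>{..k}. \<Oplus>j\<in>{..i}. u j (i - j)) = (\<Oplus>j\<in>{..k}. \<Oplus>l\<in>{..k - j}. u j l)"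
proof (induction k)
  case 0
  then show ?case by (simp add: assms)
next
  case (Suc k)
  have "(\<Oplus>j\<in>{..k}. \<Oplus>l\<in>{..Suc k - j}. u j l)
      = (\<Oplus>j\<in>{..k}. u j (Suc k - j) \<oplus> (\<Oplus>l\<in>{..k - j}. u j l))"
    by (rule finsum_cong') (auto simp: Suc_diff_le assms)
  also have "\<dots> = (\<Oplus>j\<in>{..k}. u j (Suc k - j)) \<oplus> (\<Oplus>j\<in>{..k}. \<Oplus>l\<in>{..k - j}. u j l)"
    by (rule finsum_addf) (auto simp: assms)
  finally show ?case
    using Suc by (simp add: assms a_assoc)
qed

lemma (in ring) ring_hom_finsum:
  assumes h: "h \<in> ring_hom R R" and "finite A" and "\<And>i. i \<in> A \<Longrightarrow> f i \<in> carrier R"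
  shows "h (finsum R f A) = (\<Oplus>i\<in>A. h (f i))"
  using assms(2,3)
proof (induction A)
  case empty
  show ?case by (simp add: ring_hom_zero[OF h ring_axioms ring_axioms])
next
  case (insert a A)
  then have "f \<in> A \<rightarrow> carrier R" "(\<lambda>i. h (f i)) \<in> A \<rightarrow> carrier R"
    by (auto intro: ring_hom_closed[OF h])
  with insert show ?case
    by (simp add: ring_hom_add[OF h] ring_hom_closed[OF h])
qed

lemma ring_skew_fps_ring:
  assumes "ring R" and \<sigma>: "\<sigma> \<in> ring_hom R R"
  shows "ring (skew_fps_ring R \<sigma>)"
proof -
  interpret ring R by fact
  note hom = ring_hom_funpow[OF \<sigma>]
  have cl [simp]: "(\<sigma> ^^ i) x \<in> carrier R" if "x \<in> carrier R" for i x
    using ring_hom_closed[OF hom that] .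
  have \<sigma>0 [simp]: "(\<sigma> ^^ i) \<zero>\<^bsub>R\<^esub> = \<zero>\<^bsub>R\<^esub>" for i
    using ring_hom_zero[OF hom ring_axioms ring_axioms] .
  have \<sigma>1 [simp]: "(\<sigma> ^^ i) \<one>\<^bsub>R\<^esub> = \<one>\<^bsub>R\<^esub>" for i
    using ring_hom_one[OF hom] .
  show ?thesis
  proof (rule ringI)
    show "abelian_group (skew_fps_ring R \<sigma>)"
    proof (rule abelian_groupI)
      fix f assume "f \<in> carrier (skew_fps_ring R \<sigma>)"
      then show "\<exists>g\<in>carrier (skew_fps_ring R \<sigma>).
          g \<oplus>\<^bsub>skew_fps_ring R \<sigma>\<^esub> f = \<zero>\<^bsub>skew_fps_ring R \<sigma>\<^esub>"
        by (intro bexI[of _ "\<lambda>i. \<ominus>\<^bsub>R\<^esub> f i"]) (auto simp: skew_fps_ring_def l_neg)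
    qed (auto simp: skew_fps_ring_def a_ac)
    show "monoid (skew_fps_ring R \<sigma>)"
    proof (rule monoidI)
      fix f g h
      assume "f \<in> carrier (skew_fps_ring R \<sigma>)" "g \<in> carrier (skew_fps_ring R \<sigma>)"
        "h \<in> carrier (skew_fps_ring R \<sigma>)"
      then have c [simp]: "f i \<in> carrier R" "g i \<in> carrier R" "h i \<in> carrier R" for i
        by (auto simp: skew_fps_ring_def)
      show "f \<otimes>\<^bsub>skew_fps_ring R \<sigma>\<^esub> g \<otimes>\<^bsub>skew_fps_ring R \<sigma>\<^esub> h
          = f \<otimes>\<^bsub>skew_fps_ring R \<sigma>\<^esub> (g \<otimes>\<^bsub>skew_fps_ring R \<sigma>\<^esub> h)"
      proof
        fix k
        define u where "u j l = f j \<otimes>\<^bsub>R\<^esub> ((\<sigma> ^^ j) (g l) \<otimes>\<^bsub>R\<^esub> (\<sigma> ^^ (j + l)) (h (k - (j + l))))" for j l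
        have u: "u j l \<in> carrier R" for j l by (simp add: u_def)
        have "(\<Oplus>\<^bsub>R\<^esub>i\<in>{..k}. (\<Oplus>\<^bsub>R\<^esub>j\<in>{..i}. f j \<otimes>\<^bsub>R\<^esub> (\<sigma> ^^ j) (g (i - j))) \<otimes>\<^bsub>R\<^esub> (\<sigma> ^^ i) (h (k - i)))
            = (\<Oplus>\<^bsub>R\<^esub>i\<in>{..k}. \<Oplus>\<^bsub>R\<^esub>j\<in>{..i}. u j (i - j))"
          by (rule finsum_cong')
            (auto simp: finsum_ldistr u u_def m_assoc Pi_def intro!: finsum_cong')
        also have "\<dots> = (\<Oplus>\<^bsub>R\<^esub>j\<in>{..k}. \<Oplus>\<^bsub>R\<^esub>l\<in>{..k - j}. u j l)"
          by (rule finsum_triangle) (rule u)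
        also have "\<dots> = (\<Oplus>\<^bsub>R\<^esub>j\<in>{..k}. f j \<otimes>\<^bsub>R\<^esub>
            (\<sigma> ^^ j) (\<Oplus>\<^bsub>R\<^esub>l\<in>{..k - j}. g l \<otimes>\<^bsub>R\<^esub> (\<sigma> ^^ l) (h (k - j - l))))"
          by (rule finsum_cong')
            (auto simp: ring_hom_finsum[OF hom] ring_hom_mult[OF hom] finsum_rdistr u u_def
              Pi_def funpow_add intro!: finsum_cong')
        finally show "(f \<otimes>\<^bsub>skew_fps_ring R \<sigma>\<^esub> g \<otimes>\<^bsub>skew_fps_ring R \<sigma>\<^esub> h) k
            = (f \<otimes>\<^bsub>skew_fps_ring R \<sigma>\<^esub> (g \<otimes>\<^bsub>skew_fps_ring R \<sigma>\<^esub> h)) k"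
          by (simp add: skew_fps_ring_def)
      qed
    next
      fix f assume "f \<in> carrier (skew_fps_ring R \<sigma>)"
      then have c [simp]: "f i \<in> carrier R" for i
        by (auto simp: skew_fps_ring_def)
      show "\<one>\<^bsub>skew_fps_ring R \<sigma>\<^esub> \<otimes>\<^bsub>skew_fps_ring R \<sigma>\<^esub> f = f"
      proof
        fix k
        have "(\<Oplus>\<^bsub>R\<^esub>i\<in>{..k}. (if i = 0 then \<one>\<^bsub>R\<^esub> else \<zero>\<^bsub>R\<^esub>) \<otimes>\<^bsub>R\<^esub> (\<sigma> ^^ i) (f (k - i)))
            = (\<Oplus>\<^bsub>R\<^esub>i\<in>{..k}. if 0 = i then f k else \<zero>\<^bsub>R\<^esub>)"
          by (rule finsum_cong') auto
        also have "\<dots> = f k"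
          using finsum_singleton[of 0 "{..k}" "\<lambda>_. f k"] by simp
        finally show "(\<one>\<^bsub>skew_fps_ring R \<sigma>\<^esub> \<otimes>\<^bsub>skew_fps_ring R \<sigma>\<^esub> f) k = f k"
          by (simp add: skew_fps_ring_def)
      qed
      show "f \<otimes>\<^bsub>skew_fps_ring R \<sigma>\<^esub> \<one>\<^bsub>skew_fps_ring R \<sigma>\<^esub> = f"
      proof
        fix k
        have "(\<Oplus>\<^bsub>R\<^esub>i\<in>{..k}. f i \<otimes>\<^bsub>R\<^esub> (\<sigma> ^^ i) (if k - i = 0 then \<one>\<^bsub>R\<^esub> else \<zero>\<^bsub>R\<^esub>))
            = (\<Oplus>\<^bsub>R\<^esub>i\<in>{..k}. if k = i then f i else \<zero>\<^bsub>R\<^esub>)"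
          by (rule finsum_cong') auto
        also have "\<dots> = f k"
          using finsum_singleton[of k "{..k}" f] by simp
        finally show "(f \<otimes>\<^bsub>skew_fps_ring R \<sigma>\<^esub> \<one>\<^bsub>skew_fps_ring R \<sigma>\<^esub>) k = f k"
          by (simp add: skew_fps_ring_def)
      qed
    qed (auto simp: skew_fps_ring_def)
  next
    fix f g h
    assume "f \<in> carrier (skew_fps_ring R \<sigma>)" "g \<in> carrier (skew_fps_ring R \<sigma>)"
      "h \<in> carrier (skew_fps_ring R \<sigma>)"
    then have [simp]: "f i \<in> carrier R" "g i \<in> carrier R" "h i \<in> carrier R" for i
      by (auto simp: skew_fps_ring_def)
    show "(f \<oplus>\<^bsub>skew_fps_ring R \<sigma>\<^esub> g) \<otimes>\<^bsub>skew_fps_ring R \<sigma>\<^esub> h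
        = f \<otimes>\<^bsub>skew_fps_ring R \<sigma>\<^esub> h \<oplus>\<^bsub>skew_fps_ring R \<sigma>\<^esub> g \<otimes>\<^bsub>skew_fps_ring R \<sigma>\<^esub> h"
      by (simp add: skew_fps_ring_def l_distr finsum_addf Pi_def)
    show "h \<otimes>\<^bsub>skew_fps_ring R \<sigma>\<^esub> (f \<oplus>\<^bsub>skew_fps_ring R \<sigma>\<^esub> g)
        = h \<otimes>\<^bsub>skew_fps_ring R \<sigma>\<^esub> f \<oplus>\<^bsub>skew_fps_ring R \<sigma>\<^esub> h \<otimes>\<^bsub>skew_fps_ring R \<sigma>\<^esub> g"
      by (simp add: skew_fps_ring_def ring_hom_add[OF hom] r_distr finsum_addf Pi_def)
  qed
qed

end

theory Submission
  imports Defs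
begin

text \<open>
  If \<open>e\<close> is idempotent with constant term \<open>1\<close> and lowest nonconstant coefficient \<open>e\<^sub>k\<close>,
  then comparing coefficients of \<open>x\<^sup>k\<close> in \<open>e e = e\<close> gives \<open>e\<^sub>k + e\<^sub>k = e\<^sub>k\<close>, so \<open>e\<^sub>k = 0\<close>.
\<close>

lemma skew_fps_idempotent_eq_one:
  assumes "ring R" and \<sigma>: "\<sigma> \<in> ring_hom R R"
    and idem: "idempotent_elem (skew_fps_ring R \<sigma>) e" and e0: "e 0 = \<one>\<^bsub>R\<^esub>"
  shows "e = \<one>\<^bsub>skew_fps_ring R \<sigma>\<^esub>"
proof -
  interpret ring R by fact
  note hom = ring_hom_funpow[OF \<sigma>]
  have "e \<in> carrier (skew_fps_ring R \<sigma>)"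
    and "e \<otimes>\<^bsub>skew_fps_ring R \<sigma>\<^esub> e = e"
    using idem unfolding idempotent_elem_def by blast+
  then have [simp]: "e i \<in> carrier R"
    and coeff: "(\<Oplus>\<^bsub>R\<^esub>j\<in>{..i}. e j \<otimes>\<^bsub>R\<^esub> (\<sigma> ^^ j) (e (i - j))) = e i" for i
    unfolding skew_fps_ring_def fun_eq_iff by simp_all
  have [simp]: "(\<sigma> ^^ i) x \<in> carrier R" if "x \<in> carrier R" for i x
    using ring_hom_closed[OF hom that] .
  have \<sigma>1: "(\<sigma> ^^ i) \<one>\<^bsub>R\<^esub> = \<one>\<^bsub>R\<^esub>" for i
    using ring_hom_one[OF hom] .
  have "k \<noteq> 0 \<Longrightarrow> e k = \<zero>\<^bsub>R\<^esub>" for k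
  proof (induction k rule: less_induct)
    case (less k)
    \<comment> \<open>Writing \<open>k\<close> as a successor lets the summand at index
      \<open>k\<close> be split off from the sum over \<open>{..k}\<close>.\<close>
    then obtain m where k: "k = Suc m"
      using not0_implies_Suc by blast
    \<comment> \<open>For 0 < i < k the left factor \<open>e i\<close> vanishes by induction, so
      only i = 0 contributes, giving 1 times \<open>e k\<close>.\<close>
    have "(\<Oplus>\<^bsub>R\<^esub>i\<in>{..m}. e i \<otimes>\<^bsub>R\<^esub> (\<sigma> ^^ i) (e (k - i)))
        = (\<Oplus>\<^bsub>R\<^esub>i\<in>{..m}. if 0 = i then e k else \<zero>\<^bsub>R\<^esub>)"
      by (rule finsum_cong') (auto simp: less.IH k e0)
    also have "\<dots> = e k"
      using finsum_singleton[of 0 "{..m}" "\<lambda>_. e k"] by simp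
    \<comment> \<open>The split-off summand is \<open>e k\<close> times the image of
      \<open>e 0\<close> = 1 under the k-th iterate of \<sigma>, hence again \<open>e k\<close>, as
      \<sigma> is unital.\<close>
    finally have "e k \<oplus>\<^bsub>R\<^esub> e k = e k"
      using coeff[of k] by (simp add: k e0 \<sigma>1 ring_hom_one[OF \<sigma>])
    then show ?case
      by simp
  qed
  with e0 show ?thesis
    by (simp add: skew_fps_ring_def fun_eq_iff)
qed

theorem proposition0p5:
  fixes R :: "('a, 'b) ring_scheme" and \<sigma> :: "'a \<Rightarrow> 'a"
  assumes "ring R" and "\<sigma> \<in> ring_hom R R"
  shows "{e. idempotent_elem (skew_fps_ring R \<sigma>) e \<and> e 0 = \<one>\<^bsub>R\<^esub>} = {\<one>\<^bsub>skew_fps_ring R \<sigma>\<^esub>}"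
proof -
  \<comment> \<open>The ring structure makes the unit an element of the carrier with square 1, hence
    idempotent.\<close>
  interpret S: ring "skew_fps_ring R \<sigma>"
    using assms by (rule ring_skew_fps_ring)
  have "idempotent_elem (skew_fps_ring R \<sigma>) \<one>\<^bsub>skew_fps_ring R \<sigma>\<^esub>"
    by (simp add: idempotent_elem_def)
  moreover have "\<one>\<^bsub>skew_fps_ring R \<sigma>\<^esub> 0 = \<one>\<^bsub>R\<^esub>"
    by (simp add: skew_fps_ring_def)
  ultimately show ?thesis
    using skew_fps_idempotent_eq_one[OF assms] by blast
qed

end
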